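(* Let $T\ge 2$, let $E$ be a finite set with $N$ elements, let $h_s:E\times E\to\mathbb{R}$ for $s=1,\dots,T-1$, and let $\pi$ be the probability distribution on $E^T$ given by $$\pi(z_1,\dots,z_T)=C^{-1}\exp\sum_{s=1}^{T-1}h_s(z_s,z_{s+1}),$$ where $C$ is the normalizing constant. Let $H_s$ be the $N\times N$ matrix with entries $H_s(u,v)=\exp h_s(u,v)$, $u,v\in E$. Let $S=\{s_1,s_2,\dots,s_q\}\subseteq\{1,\dots,T\}$ with $1=s_1<s_2<\cdots<s_{q-1}<s_q=T$. Then: 1. The marginal distribution of $\pi$ on $S$ is $$\pi_S(z_S)=C^{-1}\prod_{i=1}^{q-1}\left(\prod_{s=s_i}^{s_{i+1}-1}H_s\right)(z_{s_i},z_{s_{i+1}}).$$ 2. If $q\ge 3$, the marginal of $\pi$ on $S_{1,T}=S\setminus\{1,T\}$ is obtained from the formula in 1 by replacing the first factor $\left(\prod_{s=1}^{s_2-1}H_s\right)(z_1,z_{s_2})$ with $\left(\mathbf{1}^{\mathrm{T}}\prod_{s=1}^{s_2-1}H_s\right)(z_{s_2})$ and the last factor $\left(\prod_{s=s_{q-1}}^{s_q-1}H_s\right)(z_{s_{q-1}},z_T)$ with $\left(\left(\prod_{s=s_{q-1}}^{s_q-1}H_s\right)\mathbf{1}\right)(z_{s_{q-1}})$; that is, $$\pi_{S_{1,T}}(z_{S_{1,T}})=C^{-1}\left(\mathbf{1}^{\mathrm{T}}\prod_{s=1}^{s_2-1}H_s\right)(z_{s_2})\ \left[\prod_{i=2}^{q-2}\left(\prod_{s=s_i}^{s_{i+1}-1}H_s\right)(z_{s_i},z_{s_{i+1}})\right]\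 \left(\left(\prod_{s=s_{q-1}}^{s_q-1}H_s\right)\mathbf{1}\right)(z_{s_{q-1}}).$$
   Context: For $A\subseteq\{1,\dots,T\}$, $z_A=(z_s)_{s\in A}$ and $\pi_A$ denotes the marginal of $\pi$ on the coordinates in $A$. Vectors and matrices are indexed by the elements of $E$, with usual matrix products: $(HG)(u,v)=\sum_{w\in E}H(u,w)G(w,v)$, $(FH)(v)=\sum_{u\in E}F(u)H(u,v)$ for a row vector $F$, $(HB)(u)=\sum_{v\in E}H(u,v)B(v)$ for a column vector $B$. The products $\prod_{s=a}^{b}H_s$ are ordered products $H_aH_{a+1}\cdots H_b$; an empty product of scalars is $1$. $\mathbf{1}$ is the $N$-column vector with all coordinates equal to $1$, and $\mathbf{1}^{\mathrm{T}}$ its transpose. The normalizing constant is $C=\sum_{(z_1,\dots,z_T)\in E^T}\exp\sum_{s=1}^{T-1}h_s(z_s,z_{s+1})$. *)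

theory Defs
  imports "HOL-Probability.Probability"
begin

text \<open>The set $E$ is the universe of a finite type \<open>'e\<close> (so $N$ is \<open>CARD('e)\<close>), and for
  $A \subseteq \{1,\dots,T\}$ the elements of $E^A$ are the functions \<open>A \<rightarrow>\<^sub>E UNIV\<close>, which take
  the value \<open>undefined\<close> outside \<open>A\<close>.\<close>

definition energy :: "nat \<Rightarrow> (nat \<Rightarrow> 'e \<Rightarrow> 'e \<Rightarrow> real) \<Rightarrow> (nat \<Rightarrow> 'e) \<Rightarrow> real" where
  "energy T h z = (\<Sum>s = 1..T - 1. h s (z s) (z (s + 1)))"

definition norm_const :: "nat \<Rightarrow> (nat \<Rightarrow> 'e::finite \<Rightarrow> 'e \<Rightarrow> real) \<Rightarrow> real" where
  "norm_const T h = (\<Sum>z \<in> {1..T} \<rightarrow>\<^sub>E UNIV. exp (energy T h z))"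

definition gibbs :: "nat \<Rightarrow> (nat \<Rightarrow> 'e::finite \<Rightarrow> 'e \<Rightarrow> real) \<Rightarrow> (nat \<Rightarrow> 'e) pmf" where
  "gibbs T h = embed_pmf (\<lambda>z. if z \<in> {1..T} \<rightarrow>\<^sub>E UNIV
     then inverse (norm_const T h) * exp (energy T h z) else 0)"

definition marginal :: "nat set \<Rightarrow> (nat \<Rightarrow> 'e) pmf \<Rightarrow> (nat \<Rightarrow> 'e) pmf" where
  "marginal A p = map_pmf (\<lambda>z. restrict z A) p"

definition transfer_mat :: "(nat \<Rightarrow> 'e::finite \<Rightarrow> 'e \<Rightarrow> real) \<Rightarrow> nat \<Rightarrow> real^'e^'e" where
  "transfer_mat h s = (\<chi> u v. exp (h s u v))"

text \<open>The ordered product \<open>H a ** H (a + 1) ** \<dots> ** H b\<close>.\<close>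

definition mat_prod :: "(nat \<Rightarrow> real^'e^'e) \<Rightarrow> nat \<Rightarrow> nat \<Rightarrow> real^'e^'e::finite" where
  "mat_prod H a b = foldr (**) (map H [a..<Suc b]) (mat 1)"

text \<open>The weights in the definition of \<open>gibbs\<close> do form a probability mass function.\<close>

lemma norm_const_pos: "norm_const T h > 0"
proof -
  have "({1..T} \<rightarrow>\<^sub>E (UNIV :: 'a set)) \<noteq> {}"
    by (simp add: PiE_eq_empty_iff)
  then show ?thesis
    unfolding norm_const_def by (intro sum_pos) (auto intro!: finite_PiE)
qed

lemma pmf_gibbs:
  "pmf (gibbs T h) z = (if z \<in> {1..T} \<rightarrow>\<^sub>E UNIV
     then inverse (norm_const T h) * exp (energy T h z) else 0)"
proof -
  let ?A = "{1..T} \<rightarrow>\<^sub>E (UNIV :: 'a set)"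
  let ?f = "\<lambda>z. if z \<in> ?A then inverse (norm_const T h) * exp (energy T h z) else 0"
  have C: "norm_const T h > 0" by (rule norm_const_pos)
  have fin: "finite ?A" by (intro finite_PiE) auto
  have nonneg: "?f z \<ge> 0" for z using C by simp
  have "(\<integral>\<^sup>+ z. ennreal (?f z) \<partial>count_space UNIV) = (\<Sum>z\<in>?A. ennreal (?f z))"
    by (rule nn_integral_count_space'[OF fin]) auto
  also have "\<dots> = ennreal (\<Sum>z\<in>?A. ?f z)"
    using nonneg by (intro sum_ennreal)
  also have "(\<Sum>z\<in>?A. ?f z) = inverse (norm_const T h) * norm_const T h"
    unfolding norm_const_def sum_distrib_left by (intro sum.cong) auto
  also have "\<dots> = 1" using C by simp
  finally have "(\<integral>\<^sup>+ z. ennreal (?f z) \<partial>count_space UNIV) = 1" by simp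
  then show ?thesis
    unfolding gibbs_def by (intro pmf_embed_pmf nonneg)
qed

end

theory Submission
  imports Defs
begin

text \<open>The proof is the transfer-matrix method. A marginal weight of the Gibbs measure is a sum of
  products of matrix entries over all paths that pass through prescribed values at the retained
  coordinates. Prescribing some coordinates and leaving the others free means that the coordinate
  at time \<open>t\<close> ranges over a set \<open>A t\<close>, a singleton or \<open>UNIV\<close>, so the paths form a set \<open>PiE {1..T} A\<close>
  (\<open>pmf_marginal_gibbs\<close>).

  Such a sum is evaluated from left to right through the forward sums \<open>forward G A n v\<close> over the
  paths that have reached \<open>v\<close> at time \<open>n\<close>. By distributivity, one more time step multiplies the
  row vector of forward sums by the next matrix, after discarding the entries outside \<open>A n\<close>
  (\<open>forward_Suc\<close>). Across a stretch of free times nothing is discarded and the matrices multiply up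
  to an ordered product (\<open>forward_free_block\<close>); at a prescribed time only a single entry survives,
  so a sequence of prescribed times produces a scalar product of entries of such ordered products
  (\<open>forward_pinned_chain\<close>). Both formulas are this chain: they differ in whether the path is
  prescribed at the two end points, and a free end point means a sum over its value, that is,
  multiplication by the vector of ones.\<close>

section \<open>Ordered products of matrices\<close>

lemma mat_prod_empty: "b < a \<Longrightarrow> mat_prod G a b = mat 1"
  by (simp add: mat_prod_def)

lemma foldr_matrix_mult:
  fixes M :: "real^'e^'e::finite"
  shows "foldr (**) Ms M = foldr (**) Ms (mat 1) ** M"
  by (induction Ms) (simp_all add: matrix_mul_assoc)

lemma mat_prod_snoc: "a \<le> Suc b \<Longrightarrow> mat_prod G a (Suc b) = mat_prod G a b ** G (Suc b)"
  unfolding mat_prod_def by (simp add: foldr_matrix_mult[of _ "G (Suc b)"])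

section \<open>Forward sums\<close>

definition path_weight :: "(nat \<Rightarrow> real^'e^'e) \<Rightarrow> nat \<Rightarrow> (nat \<Rightarrow> 'e) \<Rightarrow> real" where
  "path_weight G n w = (\<Prod>t = 1..<n. G t $ w t $ w (Suc t))"

text \<open>The end value \<open>v\<close> replaces the constraint \<open>A n\<close> instead of being subject to it. This keeps a step
  of the recursion linear in the earlier forward sums, with the constraint at time \<open>n\<close> appearing
  only as the range of the next sum.\<close>

definition forward :: "(nat \<Rightarrow> real^'e^'e) \<Rightarrow> (nat \<Rightarrow> 'e set) \<Rightarrow> nat \<Rightarrow> 'e::finite \<Rightarrow> real" where
  "forward G A n v = (\<Sum>w \<in> PiE {1..n} (A(n := {v})). path_weight G n w)"

lemma PiE_last_value:
  fixes n :: nat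
  assumes "1 \<le> n" "w \<in> PiE {1..n} (A(n := {v}))"
  shows "w n = v"
  using PiE_mem[OF assms(2), of n] assms(1) by simp

lemma sum_PiE_split_last:
  fixes f :: "(nat \<Rightarrow> 'e::finite) \<Rightarrow> real"
  assumes "1 \<le> n"
  shows "(\<Sum>w \<in> PiE {1..n} A. f w) = (\<Sum>v \<in> A n. \<Sum>w \<in> PiE {1..n} (A(n := {v})). f w)"
proof -
  have eq: "PiE {1..n} A = (\<Union>v \<in> A n. PiE {1..n} (A(n := {v})))"
  proof (intro equalityI subsetI)
    fix w assume "w \<in> PiE {1..n} A"
    then have "w n \<in> A n" "w \<in> PiE {1..n} (A(n := {w n}))"
      using assms by (auto simp: PiE_iff)
    then show "w \<in> (\<Union>v \<in> A n. PiE {1..n} (A(n := {v})))" by blast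
  next
    fix w assume "w \<in> (\<Union>v \<in> A n. PiE {1..n} (A(n := {v})))"
    then show "w \<in> PiE {1..n} A"
      by (auto simp: PiE_iff split: if_splits)
  qed
  have disj: "PiE {1..n} (A(n := {v})) \<inter> PiE {1..n} (A(n := {v'})) = {}" if "v \<noteq> v'" for v v'
    using that PiE_last_value[OF assms, of _ A] by blast
  have "finite (PiE {1..n} (A(n := {v})))" for v
    by (intro finite_PiE) auto
  with disj show ?thesis
    unfolding eq by (intro sum.UNION_disjoint) (simp, blast+)
qed

lemma sum_path_weight_eq_forward:
  assumes "1 \<le> n"
  shows "(\<Sum>w \<in> PiE {1..n} A. path_weight G n w) = (\<Sum>v \<in> A n. forward G A n v)"
  unfolding forward_def by (rule sum_PiE_split_last[OF assms])

lemma forward_1: "forward G A 1 v = 1"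
proof -
  have "PiE {1..1} (A(1 := {v})) = {(\<lambda>t. undefined)(1 := v)}"
    by (simp add: PiE_insert_eq)
  then show ?thesis by (simp add: forward_def path_weight_def)
qed

text \<open>A path up to time \<open>n + 1\<close> that ends in \<open>v\<close> is a path up to time \<open>n\<close> with one value appended;
  the new weight factor depends on that path only through its last value, so it can be pulled out
  after grouping the paths by it.\<close>

lemma forward_Suc:
  assumes "1 \<le> n"
  shows "forward G A (Suc n) v = (\<Sum>u \<in> A n. forward G A n u * G n $ u $ v)"
proof -
  let ?ext = "\<lambda>w. w(Suc n := v)"
  have "PiE {1..Suc n} (A(Suc n := {v})) = ?ext ` PiE {1..n} (A(Suc n := {v}))"
  proof -
    have "{1..Suc n} = insert (Suc n) {1..n}" by auto
    then have "PiE {1..Suc n} (A(Suc n := {v})) =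
        (\<lambda>(y, w). w(Suc n := y)) ` ({v} \<times> PiE {1..n} (A(Suc n := {v})))"
      by (simp only: PiE_insert_eq fun_upd_same)
    also have "{v} \<times> PiE {1..n} (A(Suc n := {v})) = Pair v ` PiE {1..n} (A(Suc n := {v}))"
      by blast
    finally show ?thesis by (simp only: image_image prod.case)
  qed
  also have "PiE {1..n} (A(Suc n := {v})) = PiE {1..n} A"
    by (rule PiE_cong) auto
  finally have paths: "PiE {1..Suc n} (A(Suc n := {v})) = ?ext ` PiE {1..n} A" .
  have inj: "inj_on ?ext (PiE {1..n} A)"
  proof (rule inj_onI)
    fix w w' assume "w \<in> PiE {1..n} A" "w' \<in> PiE {1..n} A" and eq: "?ext w = ?ext w'"
    then have "w (Suc n) = w' (Suc n)"
      using PiE_arb[of w "{1..n}" A "Suc n"] PiE_arb[of w' "{1..n}" A "Suc n"] by simp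
    with eq show "w = w'" by (metis fun_upd_idem_iff fun_upd_upd)
  qed
  have weight: "path_weight G (Suc n) (?ext w) = path_weight G n w * G n $ w n $ v" for w
  proof -
    have "(\<Prod>t = 1..<n. G t $ ?ext w t $ ?ext w (Suc t)) = path_weight G n w"
      unfolding path_weight_def by (rule prod.cong) auto
    then show ?thesis
      using assms by (simp add: path_weight_def)
  qed
  have "forward G A (Suc n) v = (\<Sum>w \<in> PiE {1..n} A. path_weight G n w * G n $ w n $ v)"
    unfolding forward_def paths sum.reindex[OF inj] comp_def weight ..
  also have "\<dots> = (\<Sum>u \<in> A n. \<Sum>w \<in> PiE {1..n} (A(n := {u})). path_weight G n w * G n $ w n $ v)"
    by (rule sum_PiE_split_last[OF assms])
  also have "\<dots> = (\<Sum>u \<in> A n. forward G A n u * G n $ u $ v)"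
    unfolding forward_def sum_distrib_right
    by (intro sum.cong refl) (simp only: PiE_last_value[OF assms, of _ A])
  finally show ?thesis .
qed

text \<open>Iterating \<open>forward_Suc\<close> over free times is associativity of the matrix product. The constraint at
  the left end \<open>m\<close> stays as the range of the sum, so that the same lemma serves a block that starts
  at a prescribed time and a block that starts at a free end point.\<close>

lemma forward_free_block:
  assumes "1 \<le> m" "m < n" and free: "\<And>t. m < t \<Longrightarrow> t < n \<Longrightarrow> A t = UNIV"
  shows "forward G A n v = (\<Sum>u \<in> A m. forward G A m u * mat_prod G m (n - 1) $ u $ v)"
proof -
  from \<open>m < n\<close> have "Suc m \<le> n" by simp
  then show ?thesis using free
  proof (induction n arbitrary: v rule: dec_induct)
    case base
    obtain l where l: "m = Suc l" using \<open>1 \<le> m\<close> by (cases m) auto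
    have "mat_prod G m m = G m"
      unfolding l by (simp add: mat_prod_snoc mat_prod_empty)
    then show ?case by (simp add: forward_Suc[OF \<open>1 \<le> m\<close>])
  next
    case (step n)
    from step.hyps \<open>1 \<le> m\<close> have n: "Suc (n - 1) = n" "1 \<le> n" "m \<le> Suc (n - 1)" by auto
    have "forward G A (Suc n) v = (\<Sum>x \<in> UNIV. forward G A n x * G n $ x $ v)"
      using step.prems[of n] step.hyps by (simp add: forward_Suc[OF n(2)])
    also have "\<dots> = (\<Sum>x \<in> UNIV. \<Sum>u \<in> A m.
        forward G A m u * mat_prod G m (n - 1) $ u $ x * G n $ x $ v)"
      using step.IH step.prems by (simp add: sum_distrib_right)
    also have "\<dots> = (\<Sum>u \<in> A m. forward G A m u * (mat_prod G m (n - 1) ** G n) $ u $ v)"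
      by (subst sum.swap) (simp add: matrix_matrix_mult_def sum_distrib_left mult.assoc)
    also have "mat_prod G m (n - 1) ** G n = mat_prod G m (Suc n - 1)"
      using mat_prod_snoc[OF n(3), of G] n(1) by simp
    finally show ?case .
  qed
qed

text \<open>A single value is allowed at each prescribed time, so the sum over the left end of every block
  has one term and the forward sum picks up one scalar factor per block.\<close>

lemma forward_pinned_chain:
  assumes "j \<le> k" "1 \<le> s j"
    and incr: "\<And>i. j \<le> i \<Longrightarrow> i < k \<Longrightarrow> s i < s (Suc i)"
    and pinned: "\<And>i. j \<le> i \<Longrightarrow> i < k \<Longrightarrow> A (s i) = {z (s i)}"
    and free: "\<And>i t. j \<le> i \<Longrightarrow> i < k \<Longrightarrow> s i < t \<Longrightarrow> t < s (Suc i) \<Longrightarrow> A t = UNIV"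
  shows "forward G A (s k) (z (s k)) = forward G A (s j) (z (s j)) *
    (\<Prod>i = j..<k. mat_prod G (s i) (s (Suc i) - 1) $ z (s i) $ z (s (Suc i)))"
proof -
  have "1 \<le> s k \<and> ?thesis"
    using \<open>j \<le> k\<close> incr pinned free
  proof (induction k rule: dec_induct)
    case base
    show ?case using \<open>1 \<le> s j\<close> by simp
  next
    case (step k)
    have IH: "1 \<le> s k" "forward G A (s k) (z (s k)) = forward G A (s j) (z (s j)) *
        (\<Prod>i = j..<k. mat_prod G (s i) (s (Suc i) - 1) $ z (s i) $ z (s (Suc i)))"
      using step.IH step.prems by simp_all
    have lt: "s k < s (Suc k)" using step.hyps step.prems by simp
    have "A t = UNIV" if "s k < t" "t < s (Suc k)" for t
      using step.prems(3)[of k t] step.hyps that by simp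
    then have "forward G A (s (Suc k)) (z (s (Suc k))) = forward G A (s k) (z (s k)) *
        mat_prod G (s k) (s (Suc k) - 1) $ z (s k) $ z (s (Suc k))"
      using forward_free_block[OF IH(1) lt, of A G] step.prems(2)[of k] step.hyps by simp
    then show ?case using IH lt step.hyps by simp
  qed
  then show ?thesis by blast
qed

section \<open>Marginals of the Gibbs measure as path sums\<close>

lemma exp_energy: "exp (energy T h w) = path_weight (transfer_mat h) T w"
proof -
  have "{1..T - 1} = {1..<T}" by auto
  then show ?thesis
    by (simp add: energy_def path_weight_def transfer_mat_def exp_sum)
qed

text \<open>The paths that restrict to \<open>z\<close> on \<open>B\<close> are exactly those that are pinned to \<open>z\<close> on \<open>B\<close> and free at
  all other times, which turns the marginal into a sum over a product set.\<close>

lemma pmf_marginal_gibbs: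
  fixes h :: "nat \<Rightarrow> 'e::finite \<Rightarrow> 'e \<Rightarrow> real"
  assumes "B \<subseteq> {1..T}" and z: "z \<in> B \<rightarrow>\<^sub>E UNIV"
  shows "pmf (marginal B (gibbs T h)) z = inverse (norm_const T h) *
    (\<Sum>w \<in> PiE {1..T} (\<lambda>t. if t \<in> B then {z t} else UNIV). path_weight (transfer_mat h) T w)"
proof -
  let ?P = "PiE {1..T} (\<lambda>t. if t \<in> B then {z t} else UNIV)"
  have fin: "finite ?P" by (intro finite_PiE) auto
  have agree: "restrict w B = z \<longleftrightarrow> (\<forall>t\<in>B. w t = z t)" for w
    using z by (auto simp: fun_eq_iff restrict_def PiE_iff extensional_def)
  have fibre: "(\<lambda>w. restrict w B) -` {z} \<inter> ({1..T} \<rightarrow>\<^sub>E UNIV) = ?P"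
    using \<open>B \<subseteq> {1..T}\<close> by (auto simp: agree PiE_iff split: if_splits) blast+
  have support: "set_pmf (gibbs T h) \<subseteq> {1..T} \<rightarrow>\<^sub>E UNIV"
  proof
    fix w assume "w \<in> set_pmf (gibbs T h)"
    then show "w \<in> {1..T} \<rightarrow>\<^sub>E UNIV"
      by (rule contrapos_pp) (simp only: set_pmf_iff pmf_gibbs if_False not_not)
  qed
  have "pmf (marginal B (gibbs T h)) z = measure (gibbs T h) ((\<lambda>w. restrict w B) -` {z})"
    by (simp add: marginal_def pmf_map)
  also have "\<dots> = measure (gibbs T h) ?P"
  proof -
    have "(\<lambda>w. restrict w B) -` {z} \<inter> set_pmf (gibbs T h) = ?P \<inter> set_pmf (gibbs T h)"
      using fibre support by blast
    then have "measure (gibbs T h) ((\<lambda>w. restrict w B) -` {z} \<inter> set_pmf (gibbs T h)) =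
        measure (gibbs T h) (?P \<inter> set_pmf (gibbs T h))"
      by (rule arg_cong)
    then show ?thesis unfolding measure_Int_set_pmf .
  qed
  also have "\<dots> = (\<Sum>w \<in> ?P. pmf (gibbs T h) w)"
    by (rule measure_measure_pmf_finite[OF fin])
  also have "\<dots> = (\<Sum>w \<in> ?P. inverse (norm_const T h) * path_weight (transfer_mat h) T w)"
  proof (rule sum.cong)
    have "?P \<subseteq> {1..T} \<rightarrow>\<^sub>E UNIV" by (rule PiE_mono) auto
    then show "pmf (gibbs T h) w = inverse (norm_const T h) * path_weight (transfer_mat h) T w"
      if "w \<in> ?P" for w
      using that by (simp add: pmf_gibbs exp_energy subset_iff)
  qed simp
  finally show ?thesis by (simp add: sum_distrib_left)
qed

section \<open>The marginals on a set of times containing both end points, and on its interior\<close>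

theorem proposition2:
  fixes T q :: nat
    and h :: "nat \<Rightarrow> 'e::finite \<Rightarrow> 'e \<Rightarrow> real"
    and s :: "nat \<Rightarrow> nat"
    and S :: "nat set"
  defines "H \<equiv> transfer_mat h"
    and "C \<equiv> norm_const T h"
    and "\<pi> \<equiv> gibbs T h"
  assumes "T \<ge> 2"
    and "q \<ge> 1"
    and "S = s ` {1..q}"
    and "strict_mono_on {1..q} s"
    and "s 1 = 1"
    and "s q = T"
  shows "(\<forall>z \<in> S \<rightarrow>\<^sub>E UNIV. pmf (marginal S \<pi>) z =
           inverse C * (\<Prod>i = 1..q - 1. mat_prod H (s i) (s (i + 1) - 1) $ z (s i) $ z (s (i + 1))))
       \<and> (q \<ge> 3 \<longrightarrow> (\<forall>z \<in> (S - {1, T}) \<rightarrow>\<^sub>E UNIV. pmf (marginal (S - {1, T}) \<pi>) z =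
           inverse C * (vec 1 v* mat_prod H 1 (s 2 - 1)) $ z (s 2)
           * (\<Prod>i = 2..q - 2. mat_prod H (s i) (s (i + 1) - 1) $ z (s i) $ z (s (i + 1)))
           * (mat_prod H (s (q - 1)) (s q - 1) *v vec 1) $ z (s (q - 1))))"
proof -
  note incr = \<open>strict_mono_on {1..q} s\<close>
  have "2 \<le> q"
  proof (rule ccontr)
    assume "\<not> 2 \<le> q"
    with \<open>1 \<le> q\<close> have "q = 1" by simp
    with \<open>s 1 = 1\<close> \<open>s q = T\<close> \<open>2 \<le> T\<close> show False by simp
  qed
  have less_iff: "s i < s j \<longleftrightarrow> i < j" if "i \<in> {1..q}" "j \<in> {1..q}" for i j
    using strict_mono_on_less[OF incr that] .
  have range: "1 \<le> s i" "s i \<le> T" if "i \<in> {1..q}" for i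
    using less_iff[of i 1] less_iff[of q i] that \<open>s 1 = 1\<close> \<open>s q = T\<close> \<open>1 \<le> q\<close> by force+
  have step: "s i < s (Suc i)" if "1 \<le> i" "i < q" for i
    using less_iff[of i "Suc i"] that by simp
  have S_sub: "S \<subseteq> {1..T}" using \<open>S = s ` {1..q}\<close> range by auto
  \<comment> \<open>The sequence enumerates \<open>S\<close> in increasing order, so no time between consecutive members is
    prescribed.\<close>
  have gap: "t \<notin> S" if "1 \<le> i" "i < q" "s i < t" "t < s (Suc i)" for i t
  proof
    assume "t \<in> S"
    then obtain j where j: "j \<in> {1..q}" "t = s j" using \<open>S = s ` {1..q}\<close> by auto
    then show False using less_iff[of i j] less_iff[of j "Suc i"] that by simp
  qed

  have full: "pmf (marginal S \<pi>) z =
      inverse C * (\<Prod>i = 1..q - 1. mat_prod H (s i) (s (i + 1) - 1) $ z (s i) $ z (s (i + 1)))"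
    if z: "z \<in> S \<rightarrow>\<^sub>E UNIV" for z
  proof -
    define A where "A = (\<lambda>t. if t \<in> S then {z t} else UNIV)"
    have ST: "T \<in> S" using \<open>S = s ` {1..q}\<close> \<open>s q = T\<close> \<open>1 \<le> q\<close> by force
    have "(\<Sum>w \<in> PiE {1..T} A. path_weight H T w) = forward H A (s q) (z (s q))"
      using ST \<open>2 \<le> T\<close> \<open>s q = T\<close> by (subst sum_path_weight_eq_forward) (simp_all add: A_def)
    also have "\<dots> = forward H A (s 1) (z (s 1)) *
        (\<Prod>i = 1..<q. mat_prod H (s i) (s (Suc i) - 1) $ z (s i) $ z (s (Suc i)))"
      using \<open>1 \<le> q\<close> step range gap \<open>S = s ` {1..q}\<close>
      by (intro forward_pinned_chain) (auto simp: A_def)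
    also have "forward H A (s 1) (z (s 1)) = 1"
      unfolding \<open>s 1 = 1\<close> by (rule forward_1)
    also have "{1..<q} = {1..q - 1}" using \<open>1 \<le> q\<close> by auto
    finally show ?thesis
      using pmf_marginal_gibbs[OF S_sub z] by (simp add: C_def H_def \<pi>_def A_def)
  qed

  have inner: "pmf (marginal (S - {1, T}) \<pi>) z = inverse C * (vec 1 v* mat_prod H 1 (s 2 - 1)) $ z (s 2)
        * (\<Prod>i = 2..q - 2. mat_prod H (s i) (s (i + 1) - 1) $ z (s i) $ z (s (i + 1)))
        * (mat_prod H (s (q - 1)) (s q - 1) *v vec 1) $ z (s (q - 1))"
    if "3 \<le> q" and z: "z \<in> (S - {1, T}) \<rightarrow>\<^sub>E UNIV" for z
  proof -
    define A where "A = (\<lambda>t. if t \<in> S - {1, T} then {z t} else UNIV)"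
    have ends: "A 1 = UNIV" "A T = UNIV" by (auto simp: A_def)
    have free: "A t = UNIV" if "1 \<le> i" "i < q" "s i < t" "t < s (Suc i)" for i t
      using gap[OF that] by (simp add: A_def)
    have pinned: "A (s i) = {z (s i)}" if "2 \<le> i" "i < q" for i
    proof -
      have "s 1 < s i" "s i < s q" "s i \<in> S"
        using that less_iff[of 1 i] less_iff[of i q] \<open>S = s ` {1..q}\<close> by auto
      then show ?thesis using \<open>s 1 = 1\<close> \<open>s q = T\<close> by (simp add: A_def)
    qed
    have lt_first: "1 < s 2" and lt_last: "s (q - 1) < T"
      using step[of 1] step[of "q - 1"] \<open>3 \<le> q\<close> \<open>s 1 = 1\<close> \<open>s q = T\<close>
      by (simp_all add: numeral_2_eq_2)
    have first: "forward H A (s 2) v = (vec 1 v* mat_prod H 1 (s 2 - 1)) $ v" for v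
    proof -
      have "forward H A (s 2) v =
          (\<Sum>u \<in> A 1. forward H A 1 u * mat_prod H 1 (s 2 - 1) $ u $ v)"
        using free[of 1] \<open>3 \<le> q\<close> \<open>s 1 = 1\<close> lt_first
        by (intro forward_free_block) (auto simp: numeral_2_eq_2)
      then show ?thesis
        unfolding forward_1 ends by (simp add: vector_matrix_mult_def vec_def)
    qed
    have middle: "forward H A (s (q - 1)) (z (s (q - 1))) = forward H A (s 2) (z (s 2)) *
        (\<Prod>i = 2..<q - 1. mat_prod H (s i) (s (Suc i) - 1) $ z (s i) $ z (s (Suc i)))"
    proof (rule forward_pinned_chain)
      fix i assume "2 \<le> i" "i < q - 1"
      then show "s i < s (Suc i)" "A (s i) = {z (s i)}" using step pinned by simp_all
    next
      fix i t assume "2 \<le> i" "i < q - 1" "s i < t" "t < s (Suc i)"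
      then show "A t = UNIV" using free[of i t] by simp
    qed (use \<open>3 \<le> q\<close> lt_first in simp_all)
    have last: "forward H A T v = forward H A (s (q - 1)) (z (s (q - 1))) *
        mat_prod H (s (q - 1)) (s q - 1) $ z (s (q - 1)) $ v" for v
    proof -
      have "forward H A T v = (\<Sum>u \<in> A (s (q - 1)).
          forward H A (s (q - 1)) u * mat_prod H (s (q - 1)) (T - 1) $ u $ v)"
        using free[of "q - 1"] range[of "q - 1"] \<open>3 \<le> q\<close> \<open>s q = T\<close> lt_last
        by (intro forward_free_block) auto
      then show ?thesis using pinned[of "q - 1"] \<open>3 \<le> q\<close> \<open>s q = T\<close> by simp
    qed
    have "(\<Sum>w \<in> PiE {1..T} A. path_weight H T w) = (\<Sum>v \<in> UNIV. forward H A T v)"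
      using \<open>2 \<le> T\<close> by (subst sum_path_weight_eq_forward) (simp_all add: ends)
    also have "\<dots> = forward H A (s (q - 1)) (z (s (q - 1))) *
        (mat_prod H (s (q - 1)) (s q - 1) *v vec 1) $ z (s (q - 1))"
      unfolding last by (simp add: sum_distrib_left matrix_vector_mult_def vec_def)
    finally have total: "(\<Sum>w \<in> PiE {1..T} A. path_weight H T w) = \<dots>" .
    have "{2..<q - 1} = {2..q - 2}" using \<open>3 \<le> q\<close> by auto
    moreover have "S - {1, T} \<subseteq> {1..T}" using S_sub by auto
    ultimately show ?thesis
      using pmf_marginal_gibbs[OF _ z, of T h] total middle first
      by (simp add: C_def H_def \<pi>_def A_def mult.assoc)
  qed

  from full inner show ?thesis by blast
qed

end
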